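(* Thomas division $T$ is monotone, i.e. it is monotone for every admissible monomial ordering $\sqsubset$ on $\mathbb{M}$.
   Context: $\mathbb{M}=\{x_1^{d_1}\cdots x_n^{d_n}\mid d_i\in\mathbb{Z}_{\ge 0}\}$, and $\deg_i(u)$ is the degree of $x_i$ in $u$. An admissible monomial ordering is a total ordering on $\mathbb{M}$, compatible with multiplication, in which $1$ is the smallest element. All monomial sets are finite. Thomas division $T$: for a finite set $U\subset\mathbb{M}$ and $u\in U$, the variable $x_i$ is multiplicative for $u$ if $\deg_i(u)=\max\{\deg_i(v)\mid v\in U\}$, and nonmultiplicative otherwise. For a division $L$, $NM_L(u,U)$ is the set of nonmultiplicative variables of $u\in U$, $L(u,U)$ is the submonoid of $\mathbb{M}$ generated by the multiplicative variables, and the involutive cone is $C_L(U)=\bigcup_{u\in U}uL(u,U)$. Given an admissible ordering $\sqsubset$, a set $U$ is complete up to a monomial $w$ with respect to $\sqsubset$ if for all $u\in U$ and $x\in NM_L(u,U)$ with $u\cdot x\sqsubseteq w$ one has $u\cdot x\in C_L(U)$ (in particular, $U$ is complete up to $w$ if $u\cdot x\sqsupset w$ for all $u\in U$, $x\in NM_L(u,U)$). $L$ is monotone for $\sqsubset$ if for any finite set $U$ and any $w\in\mathbb{M}$ such that $U$ is complete up to $w$ with respect to $\sqsubset$, the following holds: for all $v\in U$ and $x\in NM_L(v,U)$ with $v\cdot x\notin C_L(U)$, the set $U\cup\{v\cdot x\}$ is complete up to $w$ with respect to $\sqsubset$. $L$ is monotone if it is monotone for every admissible ordering $\sqsubset$.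 *)

theory Defs
  imports "HOL-Library.Poly_Mapping"
begin

text \<open>
  The variables are the elements of a finite index type, so the monomials in \<open>n\<close> variables are the
  exponent maps \<open>'x \<Rightarrow>\<^sub>0 nat\<close> with \<open>CARD('x) = n\<close>. Monomials are thus written additively: \<open>+\<close> is the
  product, \<open>0\<close> is the monomial 1, and \<open>Poly_Mapping.lookup u i\<close> is the degree of \<open>u\<close> in the variable \<open>i\<close>.
\<close>

type_synonym 'x monom = "'x \<Rightarrow>\<^sub>0 nat"

abbreviation var :: "'x \<Rightarrow> 'x monom" where
  "var i \<equiv> Poly_Mapping.single i 1"

text \<open>The argument is the non-strict ordering.\<close>

definition admissible_ordering :: "('x monom \<Rightarrow> 'x monom \<Rightarrow> bool) \<Rightarrow> bool" where
  "admissible_ordering le \<longleftrightarrow>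
     class.linorder le (\<lambda>s t. le s t \<and> \<not> le t s) \<and>
     (\<forall>s t u. le s t \<longrightarrow> le (s + u) (t + u)) \<and>
     (\<forall>s. le 0 s)"

text \<open>
  A division assigns to \<open>u\<close> and \<open>U\<close> the set of multiplicative variables of \<open>u\<close>; its value only
  matters for finite \<open>U\<close> and \<open>u \<in> U\<close>.
\<close>

type_synonym 'x division = "'x monom \<Rightarrow> 'x monom set \<Rightarrow> 'x set"

definition thomas_division :: "'x division" where
  "thomas_division u U = {i. Poly_Mapping.lookup u i = Max ((\<lambda>v. Poly_Mapping.lookup v i) ` U)}"

definition nonmult_vars :: "'x division \<Rightarrow> 'x monom \<Rightarrow> 'x monom set \<Rightarrow> 'x set" where
  "nonmult_vars L u U = - L u U"

inductive_set submonoid_gen :: "'x set \<Rightarrow> 'x monom set" for X :: "'x set" where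
  one: "0 \<in> submonoid_gen X"
| generator: "i \<in> X \<Longrightarrow> var i \<in> submonoid_gen X"
| mult: "s \<in> submonoid_gen X \<Longrightarrow> t \<in> submonoid_gen X \<Longrightarrow> s + t \<in> submonoid_gen X"

definition involutive_cone :: "'x division \<Rightarrow> 'x monom set \<Rightarrow> 'x monom set" where
  "involutive_cone L U = (\<Union>u\<in>U. (\<lambda>m. u + m) ` submonoid_gen (L u U))"

definition complete_up_to ::
  "'x division \<Rightarrow> ('x monom \<Rightarrow> 'x monom \<Rightarrow> bool) \<Rightarrow> 'x monom set \<Rightarrow> 'x monom \<Rightarrow> bool" where
  "complete_up_to L le U w \<longleftrightarrow>
     (\<forall>u\<in>U. \<forall>i\<in>nonmult_vars L u U. le (u + var i) w \<longrightarrow> u + var i \<in> involutive_cone L U)"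

definition monotone_division_for ::
  "'x division \<Rightarrow> ('x monom \<Rightarrow> 'x monom \<Rightarrow> bool) \<Rightarrow> bool" where
  "monotone_division_for L le \<longleftrightarrow>
     (\<forall>U w. finite U \<longrightarrow> complete_up_to L le U w \<longrightarrow>
        (\<forall>v\<in>U. \<forall>i\<in>nonmult_vars L v U. v + var i \<notin> involutive_cone L U \<longrightarrow>
           complete_up_to L le (U \<union> {v + var i}) w))"

definition monotone_division :: "'x division \<Rightarrow> bool" where
  "monotone_division L \<longleftrightarrow> (\<forall>le. admissible_ordering le \<longrightarrow> monotone_division_for L le)"

end

theory Submission
  imports Defs
begin

text \<open>
  Two observations carry the proof. Enlarging \<open>U\<close> by a nonmultiplicative prolongation
  \<open>z = v \<cdot> x\<^sub>i\<close> does not change the maximal degrees that define Thomas division: the degree of \<open>v\<close>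
  in \<open>x\<^sub>i\<close> lies strictly below the maximum, so that of \<open>z\<close> still does not exceed it. Hence every
  old element keeps its multiplicative variables, and every old prolongation that lay in the
  involutive cone still does (\<open>thomas_division_insert_prolongation\<close>).

  The only new prolongations are those of \<open>z\<close>. If one of them were \<open>\<sqsubseteq> w\<close>, then so would be its
  divisor \<open>z\<close>; but \<open>z\<close> is itself a nonmultiplicative prolongation of \<open>v \<in> U\<close>, so completeness of
  \<open>U\<close> up to \<open>w\<close> would put it in the cone of \<open>U\<close>, against the choice of \<open>z\<close>. This second argument
  works for every division (\<open>monotone_division_if_mult_vars_preserved\<close>).
\<close>

text \<open>Since \<open>0\<close> is least, so that \<open>0 \<sqsubseteq> t\<close>, compatibility with multiplication makes a divisor precede its multiples.\<close>

lemma admissible_ordering_le_mult: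
  assumes "admissible_ordering le"
  shows "le s (s + t)"
proof -
  have "le (0 + s) (t + s)"
    using assms unfolding admissible_ordering_def by blast
  then show ?thesis
    by (simp add: add.commute)
qed

lemma admissible_ordering_trans:
  assumes "admissible_ordering le" "le s t" "le t u"
  shows "le s u"
proof -
  interpret linorder le "\<lambda>s t. le s t \<and> \<not> le t s"
    using assms(1) unfolding admissible_ordering_def by blast
  show ?thesis
    using assms(2,3) by (rule order_trans)
qed

lemma submonoid_gen_mono:
  assumes "X \<subseteq> Y"
  shows "submonoid_gen X \<subseteq> submonoid_gen Y"
proof
  fix m assume "m \<in> submonoid_gen X"
  then show "m \<in> submonoid_gen Y"
    using assms by induction (blast intro: submonoid_gen.intros)+
qed

lemma involutive_cone_mono:
  assumes "U \<subseteq> V" "\<And>u. u \<in> U \<Longrightarrow> L u U \<subseteq> L u V"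
  shows "involutive_cone L U \<subseteq> involutive_cone L V"
  unfolding involutive_cone_def
  using assms by (intro UN_mono image_mono submonoid_gen_mono)

text \<open>
  An inclusion suffices as hypothesis because it acts in the right direction twice: gaining
  multiplicative variables enlarges cones and leaves fewer prolongations to be checked.
\<close>

lemma monotone_division_if_mult_vars_preserved:
  assumes preserved: "\<And>U v i u. finite U \<Longrightarrow> v \<in> U \<Longrightarrow> i \<in> nonmult_vars L v U \<Longrightarrow> u \<in> U \<Longrightarrow>
    L u U \<subseteq> L u (insert (v + var i) U)"
  shows "monotone_division L"
  unfolding monotone_division_def monotone_division_for_def
proof (intro allI impI ballI)
  fix le U w v i
  assume adm: "admissible_ordering le"
    and fin: "finite U"
    and complete: "complete_up_to L le U w"
    and v: "v \<in> U"
    and i: "i \<in> nonmult_vars L v U"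
    and notin: "v + var i \<notin> involutive_cone L U"
  let ?z = "v + var i"
  let ?V = "insert ?z U"
  have cone: "involutive_cone L U \<subseteq> involutive_cone L ?V"
    using preserved[OF fin v i] by (intro involutive_cone_mono) auto
  have "complete_up_to L le ?V w"
    unfolding complete_up_to_def
  proof (intro ballI impI)
    fix u j
    assume u: "u \<in> ?V" and j: "j \<in> nonmult_vars L u ?V" and le: "le (u + var j) w"
    have "\<not> le ?z w"
      using complete v i notin unfolding complete_up_to_def by blast
    moreover have "le u w"
      using adm admissible_ordering_le_mult[OF adm] le by (rule admissible_ordering_trans)
    ultimately have "u \<noteq> ?z"
      by auto
    with u have "u \<in> U"
      by blast
    moreover from this j have "j \<in> nonmult_vars L u U"
      using preserved[OF fin v i] unfolding nonmult_vars_def by blast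
    ultimately have "u + var j \<in> involutive_cone L U"
      using complete le unfolding complete_up_to_def by blast
    with cone show "u + var j \<in> involutive_cone L ?V"
      by blast
  qed
  then show "complete_up_to L le (U \<union> {?z}) w"
    by simp
qed

text \<open>
  A nonmultiplicative variable of \<open>v\<close> is one whose degree in \<open>v\<close> is at least one below the maximum
  over \<open>U\<close>, so a single multiplication by it cannot exceed that maximum; no other degree changes.
\<close>

lemma thomas_division_insert_prolongation:
  assumes fin: "finite U" and v: "v \<in> U" and i: "i \<in> nonmult_vars thomas_division v U"
  shows "thomas_division u (insert (v + var i) U) = thomas_division u U"
proof -
  have le_Max: "Poly_Mapping.lookup (v + var i) k \<le> Max ((\<lambda>u. Poly_Mapping.lookup u k) ` U)" for k
  proof -
    have "Poly_Mapping.lookup v k \<le> Max ((\<lambda>u. Poly_Mapping.lookup u k) ` U)"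
      using fin v by simp
    moreover have "Poly_Mapping.lookup v i \<noteq> Max ((\<lambda>u. Poly_Mapping.lookup u i) ` U)"
      using i by (simp add: nonmult_vars_def thomas_division_def)
    ultimately show ?thesis
      by (cases "k = i") (auto simp: lookup_add lookup_single)
  qed
  have "Max ((\<lambda>u. Poly_Mapping.lookup u k) ` insert (v + var i) U) = Max ((\<lambda>u. Poly_Mapping.lookup u k) ` U)" for k
    using fin v le_Max[of k] by (subst image_insert, subst Max_insert) (auto simp: max_def)
  then show ?thesis
    by (simp only: thomas_division_def)
qed

theorem proposition4p10: "monotone_division (thomas_division :: ('x::finite) division)"
  by (rule monotone_division_if_mult_vars_preserved)
    (rule equalityD2[OF thomas_division_insert_prolongation])

end
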